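(* Let $k$ be a field of characteristic $p\ge0$ with algebraic closure $\overline k$, let $X=(x_1,\dots,x_n)$, and let $$\sigma=\sum_{I\in\mathbb N^n}\alpha_IX^I\in\overline k[[X]],\qquad \alpha_I\in\overline k,$$ where $X^I=x_1^{i_1}\cdots x_n^{i_n}$. Let $L=k(\{\alpha_I\mid I\in\mathbb N^n\})\subset\overline k$ be the field generated over $k$ by the coefficients of $\sigma$. Then $\sigma$ is algebraic over $k((X))$ (the fraction field of $k[[X]]$) if and only if there exists $r\in\mathbb N$ such that $[kL^{p^r}:k]<\infty$, where $kL^{p^r}$ is the compositum of $k$ and $L^{p^r}$ in $\overline k$.
   Context: For a field $L$ of characteristic $p>0$ and $r\in\mathbb N$, $L^{p^r}=\{f^{p^r}\mid f\in L\}$; if the characteristic is $0$, set $L^{p^r}=L$. *)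

theory Defs
  imports "HOL-Computational_Algebra.Polynomial"
begin

definition is_subfield :: "'a::field set \<Rightarrow> bool" where
  "is_subfield F \<longleftrightarrow> 0 \<in> F \<and> 1 \<in> F \<and>
     (\<forall>x\<in>F. \<forall>y\<in>F. x + y \<in> F \<and> x * y \<in> F) \<and>
     (\<forall>x\<in>F. - x \<in> F \<and> inverse x \<in> F)"

definition gen_subfield :: "'a::field set \<Rightarrow> 'a set" where
  "gen_subfield S = \<Inter>{F. is_subfield F \<and> S \<subseteq> F}"

definition algebraic_over :: "'a::field set \<Rightarrow> 'a \<Rightarrow> bool" where
  "algebraic_over k x \<longleftrightarrow>
     (\<exists>q::'a poly. q \<noteq> 0 \<and> (\<forall>i. coeff q i \<in> k) \<and> poly q x = 0)"

definition is_algebraic_closure_of :: "'a::field set \<Rightarrow> bool" where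
  "is_algebraic_closure_of k \<longleftrightarrow>
     (\<forall>q::'a poly. degree q \<ge> 1 \<longrightarrow> (\<exists>x. poly q x = 0)) \<and>
     (\<forall>x. algebraic_over k x)"

definition finite_degree :: "'a::field set \<Rightarrow> 'a set \<Rightarrow> bool" where
  "finite_degree E k \<longleftrightarrow>
     (\<exists>B. finite B \<and> B \<subseteq> E \<and>
        E = {\<Sum>b\<in>B. c b * b | c. \<forall>b\<in>B. c b \<in> k})"

definition frob_pow_set :: "'a::field set \<Rightarrow> nat \<Rightarrow> 'a set" where
  "frob_pow_set L r =
     (if CHAR('a) = 0 then L else {f ^ (CHAR('a) ^ r) | f. f \<in> L})"

text \<open>A power series is its coefficient function on exponent vectors 'v \<Rightarrow> nat.\<close>
type_synonym ('v, 'a) mps = "('v \<Rightarrow> nat) \<Rightarrow> 'a"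

definition mps_one :: "('v, 'a::comm_ring_1) mps" where
  "mps_one I = (if I = (\<lambda>_. 0) then 1 else 0)"

definition mps_mult :: "('v::finite, 'a::comm_ring_1) mps \<Rightarrow> ('v, 'a) mps \<Rightarrow> ('v, 'a) mps" where
  "mps_mult f g I = (\<Sum>J\<in>{J. \<forall>v. J v \<le> I v}. f J * g (\<lambda>v. I v - J v))"

fun mps_pow :: "('v::finite, 'a::comm_ring_1) mps \<Rightarrow> nat \<Rightarrow> ('v, 'a) mps" where
  "mps_pow f 0 = mps_one"
| "mps_pow f (Suc m) = mps_mult f (mps_pow f m)"

text \<open>sigma is algebraic over k((X)) = Frac(k[[X]]): it is a root of a nonzero
  polynomial whose coefficients lie in k[[X]] (denominators cleared).\<close>
definition mps_algebraic_over :: "'a::field set \<Rightarrow> ('v::finite, 'a) mps \<Rightarrow> bool" where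
  "mps_algebraic_over k \<sigma> \<longleftrightarrow>
     (\<exists>d::nat. \<exists>c::nat \<Rightarrow> ('v, 'a) mps.
        (\<forall>i\<le>d. \<forall>I. c i I \<in> k) \<and> (\<exists>i\<le>d. c i \<noteq> (\<lambda>_. 0)) \<and>
        (\<forall>I. (\<Sum>i\<le>d. mps_mult (c i) (mps_pow \<sigma> i) I) = 0))"

end

(*
  Sending the exponent I to the product of the p_v ^ I v, for distinct primes p_v, is injective
  and turns sums into products, so comparing these integers is a monomial order in which every
  exponent has finitely many predecessors.

  If sigma is algebraic over k((X)), then some tau = sigma ^ (p ^ r) is a root of a polynomial P over
  k[[X]] with P'(tau) nonzero.  Let e be the lowest exponent of P'(tau).  Comparing coefficients in
  P(tau - t) = P(tau) - P'(tau) t + O(t^2), where t is the tail of tau starting at I > e, shows that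
  the coefficient of tau at I is a rational function over k of the earlier ones.  So the coefficients
  of tau up to e generate all of them, and these finitely many algebraic elements generate k L^(p^r).

  Conversely, if E = k L^(p^r) is finite over k, then all powers of sigma ^ (p ^ r) lie in E[[X]],
  which is generated by a finite basis of E as a module over the domain k[[X]]; hence finitely many of
  them are linearly dependent.
*)
theory Submission
  imports Defs "HOL-Library.Function_Algebras" "HOL-Library.FuncSet"
    "HOL-Computational_Algebra.Primes"
begin

section \<open>The ring of power series in finitely many variables\<close>

typedef (overloaded) ('v, 'a) mseries = "UNIV :: ('v::finite, 'a::comm_ring_1) mps set"
  morphisms mcoeff Abs_mseries by simp

setup_lifting type_definition_mseries

lemma mseries_eqI: "(\<And>A. mcoeff f A = mcoeff g A) \<Longrightarrow> f = g"
  by (simp add: mcoeff_inject[symmetric] fun_eq_iff)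

lemma finite_exponents_below:
  fixes I :: "'v::finite \<Rightarrow> nat"
  shows "finite {J. \<forall>v. J v \<le> I v}"
proof -
  have "{J. \<forall>v. J v \<le> I v} = (\<Pi>\<^sub>E v\<in>UNIV. {..I v})"
    by (auto simp: PiE_def)
  then show ?thesis
    by (simp add: finite_PiE)
qed

text \<open>Summing over pairs is symmetric in the two factors, so commutativity and associativity
  become reindexings of finite sums.\<close>

lemma mps_mult_altdef:
  fixes f g :: "('v::finite, 'a::comm_ring_1) mps"
  shows "mps_mult f g I = (\<Sum>(A, B) | A + B = I. f A * g B)"
  unfolding mps_mult_def
  by (rule sum.reindex_bij_witness[where j = "\<lambda>J. (J, \<lambda>v. I v - J v)" and i = fst])
     (auto simp: fun_eq_iff, metis add_diff_cancel_left', metis le_add1)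

lemma finite_decompositions:
  fixes I :: "'v::finite \<Rightarrow> nat"
  shows "finite {(A, B). A + B = I}"
  by (rule finite_subset[of _ "{J. \<forall>v. J v \<le> I v} \<times> {J. \<forall>v. J v \<le> I v}"])
     (auto simp: finite_exponents_below)

text \<open>The type copy serves this instance: polynomials with power series as coefficients, their
  derivatives and the additivity of Frobenius become available from the general theory of
  rings.\<close>

instantiation mseries :: (finite, comm_ring_1) comm_ring_1
begin

lift_definition zero_mseries :: "('a, 'b) mseries" is "\<lambda>_. 0" .
lift_definition one_mseries :: "('a, 'b) mseries" is mps_one .
lift_definition plus_mseries :: "('a, 'b) mseries \<Rightarrow> ('a, 'b) mseries \<Rightarrow> ('a, 'b) mseries"
  is "\<lambda>f g I. f I + g I" .
lift_definition minus_mseries :: "('a, 'b) mseries \<Rightarrow> ('a, 'b) mseries \<Rightarrow> ('a, 'b) mseries"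
  is "\<lambda>f g I. f I - g I" .
lift_definition uminus_mseries :: "('a, 'b) mseries \<Rightarrow> ('a, 'b) mseries" is "\<lambda>f I. - f I" .
lift_definition times_mseries :: "('a, 'b) mseries \<Rightarrow> ('a, 'b) mseries \<Rightarrow> ('a, 'b) mseries"
  is mps_mult .

lemma mps_mult_assoc:
  fixes f g h :: "('a, 'b) mps"
  shows "mps_mult (mps_mult f g) h I = mps_mult f (mps_mult g h) I"
proof -
  have "mps_mult (mps_mult f g) h I
      = (\<Sum>x | fst x + snd x = I. \<Sum>y | fst y + snd y = fst x. f (fst y) * g (snd y) * h (snd x))"
    by (simp add: mps_mult_altdef sum_distrib_right case_prod_beta')
  also have "\<dots> = (\<Sum>(x, y)\<in>(SIGMA x:{x. fst x + snd x = I}. {y. fst y + snd y = fst x}).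
      f (fst y) * g (snd y) * h (snd x))"
    using finite_decompositions by (intro sum.Sigma) (auto simp: case_prod_beta')
  also have "\<dots> = (\<Sum>(x, y)\<in>(SIGMA x:{x. fst x + snd x = I}. {y. fst y + snd y = snd x}).
      f (fst x) * (g (fst y) * h (snd y)))"
    \<comment> \<open>Both sums run over triples with A + B + C = I. The bijection regroups ((A + B,
      C), (A, B)) as ((A, B + C), (B, C)).\<close>
    by (rule sum.reindex_bij_witness[where
          j = "\<lambda>(x, y). ((fst y, snd y + snd x), (snd y, snd x))" and
          i = "\<lambda>(x, y). ((fst x + fst y, snd y), (fst x, fst y))"])
       (auto simp: add.assoc mult.assoc)
  also have "\<dots> = (\<Sum>x | fst x + snd x = I. \<Sum>y | fst y + snd y = snd x.
      f (fst x) * (g (fst y) * h (snd y)))"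
    using finite_decompositions by (intro sum.Sigma[symmetric]) (auto simp: case_prod_beta')
  also have "\<dots> = mps_mult f (mps_mult g h) I"
    by (simp add: mps_mult_altdef sum_distrib_left case_prod_beta')
  finally show ?thesis .
qed

lemma mps_mult_commute:
  fixes f g :: "('a, 'b) mps"
  shows "mps_mult f g I = mps_mult g f I"
  unfolding mps_mult_altdef
  by (rule sum.reindex_bij_witness[where j = prod.swap and i = prod.swap])
     (auto simp: add.commute mult.commute)

lemma mps_one_mult:
  fixes f :: "('a, 'b) mps"
  shows "mps_mult mps_one f I = f I"
proof -
  have "mps_mult mps_one f I = (\<Sum>J\<in>{\<lambda>_. 0}. mps_one J * f (\<lambda>v. I v - J v))"
    unfolding mps_mult_def
    by (intro sum.mono_neutral_right finite_exponents_below) (auto simp: mps_one_def)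
  then show ?thesis
    by (simp add: mps_one_def)
qed

instance
proof
  fix f g h :: "('a, 'b) mseries"
  show "f * g * h = f * (g * h)"
    by transfer (simp add: mps_mult_assoc fun_eq_iff)
  show "f * g = g * f"
    by transfer (simp add: mps_mult_commute fun_eq_iff)
  show "1 * f = f"
    by transfer (simp add: mps_one_mult fun_eq_iff)
  show "(f + g) * h = f * h + g * h"
    by transfer (simp add: mps_mult_def distrib_right sum.distrib fun_eq_iff)
  show "(0 :: ('a, 'b) mseries) \<noteq> 1"
    by transfer (auto simp: mps_one_def fun_eq_iff)
qed (transfer; simp add: fun_eq_iff algebra_simps)+

end

lemma mcoeff_0 [simp]: "mcoeff 0 A = 0"
  and mcoeff_1: "mcoeff 1 A = (if A = 0 then 1 else 0)"
  and mcoeff_add [simp]: "mcoeff (f + g) A = mcoeff f A + mcoeff g A"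
  and mcoeff_diff [simp]: "mcoeff (f - g) A = mcoeff f A - mcoeff g A"
  and mcoeff_uminus [simp]: "mcoeff (- f) A = - mcoeff f A"
  by (transfer; simp add: mps_one_def zero_fun_def)+

lemma mcoeff_mult: "mcoeff (f * g) I = (\<Sum>(A, B) | A + B = I. mcoeff f A * mcoeff g B)"
  by transfer (rule mps_mult_altdef)

lemma mcoeff_sum [simp]: "mcoeff (sum f S) A = (\<Sum>i\<in>S. mcoeff (f i) A)"
  by (induction S rule: infinite_finite_induct) auto

lemma mps_pow_conv_power: "mps_pow (mcoeff f) n = mcoeff (f ^ n)"
  by (induction n) (simp_all add: one_mseries.rep_eq times_mseries.rep_eq)

text \<open>With exponent 0 this also embeds the constants, so multiplying by
  \<open>mmonom c 0\<close> acts as scalar multiplication.\<close>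

lift_definition mmonom :: "'a \<Rightarrow> ('v \<Rightarrow> nat) \<Rightarrow> ('v::finite, 'a::comm_ring_1) mseries"
  is "\<lambda>c A B. if A = B then c else 0" .

lemma mcoeff_mmonom: "mcoeff (mmonom c A) B = (if A = B then c else 0)"
  by transfer simp

lemma mcoeff_mmonom_0_mult:
  fixes f :: "('v::finite, 'a::comm_ring_1) mseries"
  shows "mcoeff (mmonom c 0 * f) I = c * mcoeff f I"
proof -
  have "mcoeff (mmonom c 0 * f) I = (\<Sum>(A, B)\<in>{(0 :: 'v \<Rightarrow> nat, I)}. mcoeff (mmonom c 0) A * mcoeff f B)"
    unfolding mcoeff_mult
    by (rule sum.mono_neutral_right[OF finite_decompositions])
       (auto simp: mcoeff_mmonom split: if_splits)
  then show ?thesis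
    by (simp add: mcoeff_mmonom)
qed

lemma mmonom_mult: "mmonom c A * mmonom d B = mmonom (c * d) (A + B)"
proof (rule mseries_eqI)
  fix I
  have "mcoeff (mmonom c A * mmonom d B) I
      = (\<Sum>(A', B')\<in>(if A + B = I then {(A, B)} else {}).
          mcoeff (mmonom c A) A' * mcoeff (mmonom d B) B')"
    unfolding mcoeff_mult
    by (intro sum.mono_neutral_right finite_decompositions) (auto simp: mcoeff_mmonom split: if_splits)
  then show "mcoeff (mmonom c A * mmonom d B) I = mcoeff (mmonom (c * d) (A + B)) I"
    by (simp add: mcoeff_mmonom)
qed

lemma mmonom_power: "mmonom c A ^ n = mmonom (c ^ n) (\<lambda>v. n * A v)"
proof (induction n)
  case 0
  show ?case
    by (rule mseries_eqI) (auto simp: mcoeff_1 mcoeff_mmonom zero_fun_def)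
next
  case (Suc n)
  then show ?case
    by (simp add: mmonom_mult plus_fun_def)
qed

lemma of_nat_mseries: "of_nat n = mmonom (of_nat n) 0"
  by (induction n) (auto intro!: mseries_eqI simp: mcoeff_1 mcoeff_mmonom zero_fun_def)

text \<open>\<open>of_nat n\<close> is a constant series, so it vanishes exactly when n does in the
  coefficient ring. This transfers Frobenius arguments between series and coefficients.\<close>

lemma CHAR_mseries: "CHAR(('v::finite, 'a::comm_ring_1) mseries) = CHAR('a)"
proof (rule CHAR_eqI)
  show "of_nat CHAR('a) = (0 :: ('v, 'a) mseries)"
    by (rule mseries_eqI) (simp add: of_nat_mseries mcoeff_mmonom)
next
  fix n assume "of_nat n = (0 :: ('v, 'a) mseries)"
  then have "mcoeff (of_nat n :: ('v, 'a) mseries) 0 = 0"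
    by simp
  then show "CHAR('a) dvd n"
    by (simp add: of_nat_mseries mcoeff_mmonom of_nat_eq_0_iff_char_dvd)
qed

subsection \<open>Weights of exponents\<close>

text \<open>The variables form an arbitrary finite type without a given enumeration, so the distinct
  primes attached to them are merely chosen.\<close>

definition exponent_prime :: "'v::finite \<Rightarrow> nat" where
  "exponent_prime = (SOME p. inj p \<and> (\<forall>v. prime (p v)))"

lemma exponent_prime:
  fixes v :: "'v::finite"
  shows "inj (exponent_prime :: 'v \<Rightarrow> nat)" "prime (exponent_prime v)"
proof -
  obtain P :: "nat set" where P: "finite P" "P \<subseteq> {p. prime p}" "card P = card (UNIV :: 'v set)"
    using infinite_arbitrarily_large[OF primes_infinite] by metis
  then obtain p where p: "bij_betw p (UNIV :: 'v set) P"
    by (metis finite_same_card_bij finite)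
  have "inj p \<and> (\<forall>v. prime (p v))"
    using p P by (auto simp: bij_betw_def)
  then have "inj (exponent_prime :: 'v \<Rightarrow> nat) \<and> (\<forall>v::'v. prime (exponent_prime v))"
    unfolding exponent_prime_def
    by (rule someI[where P = "\<lambda>p. inj p \<and> (\<forall>v. prime (p v))"])
  then show "inj (exponent_prime :: 'v \<Rightarrow> nat)" "prime (exponent_prime v)"
    by auto
qed

definition weight :: "('v::finite \<Rightarrow> nat) \<Rightarrow> nat" where
  "weight A = (\<Prod>v\<in>UNIV. exponent_prime v ^ A v)"

lemma weight_add: "weight (A + B) = weight A * weight B"
  by (simp add: weight_def power_add prod.distrib)

lemma weight_scale: "weight (\<lambda>v. n * A v) = weight A ^ n"
  by (simp add: weight_def prod_power_distrib mult.commute[of n] power_mult)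

lemma weight_pos [simp]: "weight A > 0"
  by (simp add: weight_def prod_pos prime_gt_0_nat exponent_prime(2))

lemma weight_eq_iff [simp]: "weight A = weight B \<longleftrightarrow> A = B"
proof
  \<comment> \<open>Unique factorisation: each entry of an exponent can be read off from the weight
    as the multiplicity of the corresponding prime.\<close>
  have mult: "multiplicity (exponent_prime v) (weight A) = A v" for A :: "'a \<Rightarrow> nat" and v
  proof -
    have "multiplicity (exponent_prime v) (weight A)
        = (\<Sum>u\<in>UNIV. multiplicity (exponent_prime v) (exponent_prime u ^ A u))"
      unfolding weight_def
      by (intro prime_elem_multiplicity_prod_distrib)
         (auto simp: exponent_prime(2) exponent_prime(2)[THEN prime_gt_0_nat, THEN gr_implies_not0])
    also have "\<dots> = (\<Sum>u\<in>UNIV. if u = v then A v else 0)"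
      by (intro sum.cong)
         (auto simp: multiplicity_distinct_prime_power exponent_prime inj_eq[OF exponent_prime(1)])
    finally show ?thesis by simp
  qed
  show "A = B" if "weight A = weight B"
    using mult[of _ A] mult[of _ B] that by (auto simp: fun_eq_iff)
qed simp

lemma finite_weight_le:
  fixes n :: nat
  shows "finite {A :: 'v \<Rightarrow> nat. weight (A :: 'v::finite \<Rightarrow> nat) \<le> n}"
  by (rule finite_imageD[of weight]) (auto intro!: finite_subset[of _ "{..n}"] inj_onI)

text \<open>A lower bound on the order of a series, written multiplicatively: bounds of factors
  multiply, and the trivial bound is 1, as weights are positive.\<close>

definition vanishes_below :: "nat \<Rightarrow> ('v::finite, 'a::comm_ring_1) mseries \<Rightarrow> bool" where
  "vanishes_below n f \<longleftrightarrow> (\<forall>A. weight A < n \<longrightarrow> mcoeff f A = 0)"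

lemma vanishes_below_1: "vanishes_below 1 f"
  by (simp add: vanishes_below_def less_Suc_eq_le weight_pos[THEN gr_implies_not0])

text \<open>If \<open>weight A * weight B < m * n\<close>, then A lies below m or B lies below n, so
  every term of the convolution has a zero factor.\<close>

lemma vanishes_below_mult:
  fixes f g :: "('v::finite, 'a::comm_ring_1) mseries"
  assumes "vanishes_below m f" "vanishes_below n g"
  shows "vanishes_below (m * n) (f * g)"
  unfolding vanishes_below_def
proof (intro allI impI)
  fix I :: "'v \<Rightarrow> nat" assume I: "weight I < m * n"
  have "mcoeff f A * mcoeff g B = 0" if "A + B = I" for A B
  proof (cases "weight A < m")
    case False
    then have "weight B < n"
      using I that by (metis weight_add mult_le_mono not_le)
    then show ?thesis
      using assms by (simp add: vanishes_below_def)
  qed (use assms in \<open>simp add: vanishes_below_def\<close>)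
  then show "mcoeff (f * g) I = 0"
    by (auto simp: mcoeff_mult intro!: sum.neutral)
qed

text \<open>Any other decomposition of A + B has the same product of weights but, by injectivity, a
  different first weight; hence one of its two parts lies below the corresponding bound.\<close>

lemma mcoeff_mult_lowest:
  fixes f g :: "('v::finite, 'a::comm_ring_1) mseries"
  assumes "vanishes_below (weight A) f" "vanishes_below (weight B) g"
  shows "mcoeff (f * g) (A + B) = mcoeff f A * mcoeff g B"
proof -
  have "mcoeff f A' * mcoeff g B' = 0" if eq: "A' + B' = A + B" and "(A', B') \<noteq> (A, B)" for A' B'
  proof (cases "weight A' < weight A")
    case False
    have "A' \<noteq> A"
      using that by (metis add_left_cancel)
    then have "weight A < weight A'"
      using False by (meson linorder_neqE_nat weight_eq_iff)
    moreover have "weight A' * weight B' = weight A * weight B"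
      using eq by (metis weight_add)
    ultimately have "weight B' < weight B"
      using mult_less_le_imp_less[of "weight A" "weight A'" "weight B" "weight B'"]
      by (cases "weight B \<le> weight B'") auto
    then show ?thesis
      using assms by (simp add: vanishes_below_def)
  qed (use assms in \<open>simp add: vanishes_below_def\<close>)
  then have "mcoeff (f * g) (A + B) = (\<Sum>(A', B')\<in>{(A, B)}. mcoeff f A' * mcoeff g B')"
    unfolding mcoeff_mult by (intro sum.mono_neutral_right finite_decompositions) auto
  then show ?thesis by simp
qed

lemma lowest_exponent:
  assumes "f \<noteq> 0"
  obtains A where "mcoeff f A \<noteq> 0" "vanishes_below (weight A) f"
proof -
  from assms obtain B where "mcoeff f B \<noteq> 0"
    by (metis mseries_eqI mcoeff_0)
  then obtain A where "mcoeff f A \<noteq> 0" "\<forall>B. mcoeff f B \<noteq> 0 \<longrightarrow> weight A \<le> weight B"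
    using ex_has_least_nat[of "\<lambda>A. mcoeff f A \<noteq> 0" B weight] by blast
  then show thesis
    by (intro that[of A]) (auto simp: vanishes_below_def not_le[symmetric])
qed

text \<open>The product of the two lowest nonzero coefficients survives at the sum of their
  exponents.\<close>

instance mseries :: (finite, idom) idom
proof
  fix f g :: "('a, 'b) mseries" assume "f \<noteq> 0" "g \<noteq> 0"
  obtain A where A: "mcoeff f A \<noteq> 0" "vanishes_below (weight A) f"
    using lowest_exponent \<open>f \<noteq> 0\<close> .
  obtain B where B: "mcoeff g B \<noteq> 0" "vanishes_below (weight B) g"
    using lowest_exponent \<open>g \<noteq> 0\<close> .
  have "mcoeff (f * g) (A + B) \<noteq> 0"
    using A B by (simp add: mcoeff_mult_lowest)
  then show "f * g \<noteq> 0"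
    by auto
qed

section \<open>Truncations and Frobenius powers of series\<close>

lift_definition restrict_exponents ::
  "('v \<Rightarrow> nat) set \<Rightarrow> ('v::finite, 'a::comm_ring_1) mseries \<Rightarrow> ('v, 'a) mseries"
  is "\<lambda>S f A. if A \<in> S then f A else 0" .

lemma mcoeff_restrict_exponents:
  "mcoeff (restrict_exponents S f) A = (if A \<in> S then mcoeff f A else 0)"
  by transfer simp

lemma restrict_exponents_finite:
  assumes "finite S"
  shows "restrict_exponents S f = (\<Sum>A\<in>S. mmonom (mcoeff f A) A)"
  using assms by (auto intro!: mseries_eqI simp: mcoeff_restrict_exponents mcoeff_mmonom)

text \<open>Frobenius is additive on finite sums only, so it is applied to a truncation of f into
  monomials plus a tail too high to reach J. The right-hand sum has at most one term; an empty sum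
  records a zero coefficient.\<close>

lemma mcoeff_power_CHAR:
  fixes f :: "('v::finite, 'a::idom) mseries"
  assumes p: "CHAR('a) > 0" and q: "q = CHAR('a) ^ r"
  shows "mcoeff (f ^ q) J = (\<Sum>A | (\<lambda>v. q * A v) = J. mcoeff f A ^ q)"
proof -
  define S where "S = {A :: 'v \<Rightarrow> nat. weight A \<le> weight J}"
  define t where "t = f - restrict_exponents S f"
  have "finite S"
    unfolding S_def by (rule finite_weight_le)
  have char: "prime CHAR(('v, 'a) mseries)" "q = CHAR(('v, 'a) mseries) ^ r"
    using p q prime_CHAR_semidom[where ?'a = 'a] by (auto simp: CHAR_mseries)
  have "q > 0"
    using p q by simp
  \<comment> \<open>The bound exceeds \<open>weight J\<close> by 1 because S keeps all weights up to
    and including that of J. The power \<open>t ^ q\<close> inherits it, as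
    \<open>t ^ (q - 1)\<close> satisfies the trivial bound 1.\<close>
  have "vanishes_below (weight J + 1) t"
    by (auto simp: vanishes_below_def t_def S_def mcoeff_restrict_exponents)
  then have "vanishes_below (weight J + 1) (t * t ^ (q - 1))"
    using vanishes_below_mult[OF _ vanishes_below_1] by fastforce
  then have t: "mcoeff (t ^ q) J = 0"
    using \<open>q > 0\<close> by (simp add: vanishes_below_def power_eq_if)
  have "mcoeff (f ^ q) J = mcoeff ((restrict_exponents S f + t) ^ q) J"
    by (simp add: t_def)
  also have "\<dots> = (\<Sum>A\<in>S. mcoeff (mmonom (mcoeff f A) A ^ q) J)"
    by (simp add: freshmans_dream'[OF char] freshmans_dream_sum'[OF char] t
        restrict_exponents_finite[OF \<open>finite S\<close>])
  also have "\<dots> = (\<Sum>A\<in>S. if (\<lambda>v. q * A v) = J then mcoeff f A ^ q else 0)"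
    by (simp add: mmonom_power mcoeff_mmonom)
  also have "\<dots> = (\<Sum>A | A \<in> S \<and> (\<lambda>v. q * A v) = J. mcoeff f A ^ q)"
    using \<open>finite S\<close> by (simp add: sum.inter_filter)
  \<comment> \<open>An A with q A = J lies in S automatically, since \<open>weight A\<close> is at
    most \<open>weight A ^ q\<close>, which is \<open>weight J\<close>.\<close>
  also have "{A. A \<in> S \<and> (\<lambda>v. q * A v) = J} = {A. (\<lambda>v. q * A v) = J}"
    using \<open>q > 0\<close> by (auto simp: S_def weight_scale Suc_le_eq intro!: self_le_power)
  finally show ?thesis .
qed

subsection \<open>Subfields and series with restricted coefficients\<close>

lemma subfieldD:
  assumes "is_subfield F"
  shows "0 \<in> F" "1 \<in> F" "x \<in> F \<Longrightarrow> y \<in> F \<Longrightarrow> x + y \<in> F" "x \<in> F \<Longrightarrow> y \<in> F \<Longrightarrow> x * y \<in> F"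
    "x \<in> F \<Longrightarrow> - x \<in> F" "x \<in> F \<Longrightarrow> inverse x \<in> F"
  using assms by (auto simp: is_subfield_def)

lemma subfield_sum: "is_subfield F \<Longrightarrow> (\<And>i. i \<in> S \<Longrightarrow> f i \<in> F) \<Longrightarrow> sum f S \<in> F"
  by (induction S rule: infinite_finite_induct) (auto simp: subfieldD)

lemma subfield_power: "is_subfield F \<Longrightarrow> x \<in> F \<Longrightarrow> x ^ n \<in> F"
  by (induction n) (auto simp: subfieldD)

lemma subfield_gen_subfield: "is_subfield (gen_subfield S)"
  unfolding is_subfield_def gen_subfield_def by auto

lemma subset_gen_subfield: "S \<subseteq> gen_subfield S"
  unfolding gen_subfield_def by auto

lemma gen_subfield_least: "is_subfield F \<Longrightarrow> S \<subseteq> F \<Longrightarrow> gen_subfield S \<subseteq> F"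
  unfolding gen_subfield_def by auto

text \<open>For a subfield F of K this is F[[X]], realised as a subring of K[[X]].\<close>

definition series_over :: "'a::field set \<Rightarrow> ('v::finite, 'a) mseries set" where
  "series_over F = {f. \<forall>A. mcoeff f A \<in> F}"

context
  fixes F :: "'a::field set"
  assumes F: "is_subfield F"
begin

lemma series_over_0: "0 \<in> series_over F"
  and series_over_1: "1 \<in> series_over F"
  by (auto simp: series_over_def subfieldD[OF F] mcoeff_1)

lemma series_over_add: "f \<in> series_over F \<Longrightarrow> g \<in> series_over F \<Longrightarrow> f + g \<in> series_over F"
  and series_over_uminus: "f \<in> series_over F \<Longrightarrow> - f \<in> series_over F"
  by (auto simp: series_over_def subfieldD[OF F])

lemma series_over_mult: "f \<in> series_over F \<Longrightarrow> g \<in> series_over F \<Longrightarrow> f * g \<in> series_over F"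
  by (auto simp: series_over_def mcoeff_mult intro!: subfield_sum[OF F] subfieldD[OF F])

lemma series_over_sum: "(\<And>i. i \<in> S \<Longrightarrow> f i \<in> series_over F) \<Longrightarrow> sum f S \<in> series_over F"
  by (induction S rule: infinite_finite_induct) (auto intro: series_over_0 series_over_add)

lemma series_over_power: "f \<in> series_over F \<Longrightarrow> f ^ n \<in> series_over F"
  by (induction n) (auto intro: series_over_1 series_over_mult)

lemma series_over_poly:
  "(\<And>i. coeff P i \<in> series_over F) \<Longrightarrow> x \<in> series_over F \<Longrightarrow> poly P x \<in> series_over F"
proof (induction P)
  case (pCons a P)
  have "coeff P i \<in> series_over F" for i
    using pCons.prems(1)[of "Suc i"] by simp
  moreover have "a \<in> series_over F"
    using pCons.prems(1)[of 0] by simp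
  ultimately show ?case
    using pCons by (auto intro: series_over_add series_over_mult)
qed (simp add: series_over_0)

end

text \<open>Turns algebraicity into a root of a polynomial over the domain of series, so that
  degrees and derivatives can be used.\<close>

lemma mps_algebraic_over_iff:
  fixes k :: "'a::field set" and \<sigma> :: "('v::finite, 'a) mps"
  assumes k: "is_subfield k"
  shows "mps_algebraic_over k \<sigma> \<longleftrightarrow>
    (\<exists>P. P \<noteq> 0 \<and> (\<forall>i. coeff P i \<in> series_over k) \<and> poly P (Abs_mseries \<sigma>) = 0)"
    (is "?L \<longleftrightarrow> (\<exists>P. ?R P)")
proof
  assume ?L
  then obtain d and c :: "nat \<Rightarrow> ('v, 'a) mps" where c: "\<And>i I. i \<le> d \<Longrightarrow> c i I \<in> k"
    and ne: "\<exists>i\<le>d. c i \<noteq> (\<lambda>_. 0)"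
    and root: "\<And>I. (\<Sum>i\<le>d. mps_mult (c i) (mps_pow \<sigma> i) I) = 0"
    unfolding mps_algebraic_over_def by blast
  define P where "P = (\<Sum>i\<le>d. monom (Abs_mseries (c i)) i)"
  have coeff: "coeff P i = (if i \<le> d then Abs_mseries (c i) else 0)" for i
    by (simp add: P_def coeff_sum)
  have "P \<noteq> 0"
  proof
    assume "P = 0"
    then have "mcoeff (Abs_mseries (c i)) = mcoeff 0" if "i \<le> d" for i
      using coeff[of i] that by simp
    then show False
      using ne by (auto simp: Abs_mseries_inverse fun_eq_iff)
  qed
  moreover have "\<forall>i. coeff P i \<in> series_over k"
    using c by (auto simp: coeff series_over_def Abs_mseries_inverse subfieldD[OF k])
  moreover have "poly P (Abs_mseries \<sigma>) = 0"
  proof (rule mseries_eqI)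
    fix I
    have "mcoeff (Abs_mseries (c i) * Abs_mseries \<sigma> ^ i) I = mps_mult (c i) (mps_pow \<sigma> i) I" for i
      using mps_pow_conv_power[of "Abs_mseries \<sigma>"]
      by (simp add: times_mseries.rep_eq Abs_mseries_inverse)
    then show "mcoeff (poly P (Abs_mseries \<sigma>)) I = mcoeff 0 I"
      using root by (simp add: P_def poly_sum poly_monom)
  qed
  ultimately show "\<exists>P. ?R P" by blast
next
  assume "\<exists>P. ?R P"
  then obtain P where P: "?R P" by blast
  have "(\<Sum>i\<le>degree P. mps_mult (mcoeff (coeff P i)) (mps_pow \<sigma> i) I) = 0" for I
  proof -
    have "mcoeff (poly P (Abs_mseries \<sigma>)) I = 0"
      using P by simp
    then show ?thesis
      using mps_pow_conv_power[of "Abs_mseries \<sigma>"]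
      by (simp add: poly_altdef times_mseries.rep_eq Abs_mseries_inverse)
  qed
  moreover have "mcoeff (coeff P (degree P)) \<noteq> (\<lambda>_. 0)"
    using P by (metis leading_coeff_0_iff mcoeff_0 mseries_eqI)
  ultimately show ?L
    unfolding mps_algebraic_over_def using P
    by (intro exI[of _ "degree P"] exI[of _ "\<lambda>i. mcoeff (coeff P i)"]) (auto simp: series_over_def)
qed

subsection \<open>Finite extensions\<close>

text \<open>Sums over an infinite B default to 0, so this is the linear span only for finite B;
  hence the finiteness assumption in \<open>span_over_base\<close>.\<close>

definition span_over :: "'a::field set \<Rightarrow> 'a set \<Rightarrow> 'a set" where
  "span_over k B = {\<Sum>b\<in>B. c b * b | c. \<forall>b\<in>B. c b \<in> k}"

lemma finite_degree_iff: "finite_degree E k \<longleftrightarrow> (\<exists>B. finite B \<and> B \<subseteq> E \<and> E = span_over k B)"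
  by (simp add: finite_degree_def span_over_def)

context
  fixes k :: "'a::field set"
  assumes k: "is_subfield k"
begin

lemma span_over_0: "0 \<in> span_over k B"
  by (auto simp: span_over_def intro!: exI[of _ "\<lambda>_. 0"] subfieldD[OF k])

lemma span_over_add: "x \<in> span_over k B \<Longrightarrow> y \<in> span_over k B \<Longrightarrow> x + y \<in> span_over k B"
  unfolding span_over_def
  by (force simp: sum.distrib distrib_right intro: subfieldD(3)[OF k])

lemma span_over_scale: "a \<in> k \<Longrightarrow> x \<in> span_over k B \<Longrightarrow> a * x \<in> span_over k B"
  unfolding span_over_def
  by (clarsimp simp: sum_distrib_left, rule_tac x = "\<lambda>b. a * c b" in exI)
     (auto simp: mult.assoc intro: subfieldD(4)[OF k])

lemma span_over_sum: "(\<And>i. i \<in> S \<Longrightarrow> f i \<in> span_over k B) \<Longrightarrow> sum f S \<in> span_over k B"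
  by (induction S rule: infinite_finite_induct) (auto simp: span_over_0 span_over_add)

lemma span_over_base:
  assumes "finite B" "b \<in> B"
  shows "b \<in> span_over k B"
proof -
  have "b = (\<Sum>b'\<in>B. (if b' = b then 1 else 0) * b')"
    using assms by (simp add: if_distribR if_distrib[of "\<lambda>x. x * _"] cong: if_cong)
  then show ?thesis
    unfolding span_over_def using subfieldD[OF k] by fastforce
qed

text \<open>Reduces a property of the whole span to its generators; V is typically the preimage of
  another span under multiplication by a fixed element.\<close>

lemma span_over_least:
  assumes "0 \<in> V" "\<And>x y. x \<in> V \<Longrightarrow> y \<in> V \<Longrightarrow> x + y \<in> V"
    and "\<And>a b. a \<in> k \<Longrightarrow> b \<in> B \<Longrightarrow> a * b \<in> V"
  shows "span_over k B \<subseteq> V"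
proof -
  have "sum f S \<in> V" if "\<And>i. i \<in> S \<Longrightarrow> f i \<in> V" for f and S :: "'a set"
    using that by (induction S rule: infinite_finite_induct) (auto simp: assms)
  then show ?thesis
    using assms(3) by (auto simp: span_over_def)
qed

lemma span_over_mult:
  assumes "finite B" "finite C" "finite D" "\<And>b c. b \<in> B \<Longrightarrow> c \<in> C \<Longrightarrow> b * c \<in> span_over k D"
    and "x \<in> span_over k B" "y \<in> span_over k C"
  shows "x * y \<in> span_over k D"
proof -
  have *: "b * z \<in> span_over k D" if "b \<in> B" "z \<in> span_over k C" for b z
  proof -
    have "span_over k C \<subseteq> {z. b * z \<in> span_over k D}"
      using that(1) assms
      by (intro span_over_least)
         (auto simp: span_over_0 distrib_left span_over_add mult.left_commute[of b] span_over_scale)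
    then show ?thesis
      using that(2) by blast
  qed
  have "span_over k B \<subseteq> {x. x * y \<in> span_over k D}"
    using assms *
    by (intro span_over_least)
       (auto simp: span_over_0 distrib_right span_over_add mult.assoc span_over_scale)
  then show ?thesis
    using assms by blast
qed

text \<open>For nonzero y, a relation a + y q(y) = 0 over k with a nonzero gives the inverse of y as
  - q(y) / a, a polynomial expression in y and hence an element of the ring.\<close>

lemma subring_is_subfield:
  assumes alg: "\<And>x. algebraic_over k x"
    and R: "k \<subseteq> R" "\<And>x y. x \<in> R \<Longrightarrow> y \<in> R \<Longrightarrow> x + y \<in> R" "\<And>x y. x \<in> R \<Longrightarrow> y \<in> R \<Longrightarrow> x * y \<in> R"
  shows "is_subfield R"
proof -
  have k_R: "x \<in> R" if "x \<in> k" for x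
    using that R(1) by blast
  have minus: "- x \<in> R" if "x \<in> R" for x
    using R(3)[of "- 1" x] that k_R subfieldD[OF k] by auto
  have poly: "poly q y \<in> R" if "y \<in> R" "\<forall>i. coeff q i \<in> k" for q y
    using that(2)
  proof (induction q)
    case (pCons a q)
    have "a \<in> k" "\<forall>i. coeff q i \<in> k"
      using pCons.prems by (metis coeff_pCons_0, metis coeff_pCons_Suc)
    then show ?case
      using pCons.IH that(1) by (simp add: R(2,3) k_R)
  qed (use k_R subfieldD[OF k] in auto)
  have "inverse y \<in> R" if "y \<in> R" "y \<noteq> 0" for y
  proof -
    obtain q where "q \<noteq> 0" "\<forall>i. coeff q i \<in> k" "poly q y = 0"
      using alg[of y] by (auto simp: algebraic_over_def)
    then show ?thesis
    proof (induction q)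
      case (pCons a q)
      have aq: "a \<in> k" "\<forall>i. coeff q i \<in> k"
        using pCons.prems by (metis coeff_pCons_0, metis coeff_pCons_Suc)
      show ?case
      proof (cases "a = 0")
        \<comment> \<open>A zero constant term is removed by cancelling the nonzero factor y, which
          leaves a shorter relation.\<close>
        case True
        then show ?thesis
          using pCons that aq by (auto simp: pCons_eq_0_iff)
      next
        case False
        then have "inverse y = inverse a * - poly q y"
          using pCons.prems(3) that(2) by (simp add: field_simps add_eq_0_iff)
        then show ?thesis
          using poly[OF that(1) aq(2)] aq(1) subfieldD(6)[OF k] by (simp add: R(3) minus k_R)
      qed
    qed simp
  qed
  then show ?thesis
    using R minus k_R subfieldD[OF k] unfolding is_subfield_def by (metis inverse_zero)
qed

text \<open>The products of generators of M with the powers of x below the degree of a relation for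
  x span a ring containing M and x. Algebraicity over k makes this ring a field.\<close>

lemma finite_degree_adjoin:
  assumes alg: "\<And>x. algebraic_over k x" and M: "is_subfield M" "finite_degree M k" "k \<subseteq> M"
  shows "finite_degree (gen_subfield (insert x M)) k"
proof -
  obtain B where B: "finite B" "B \<subseteq> M" "M = span_over k B"
    using M(2) by (auto simp: finite_degree_iff)
  obtain q where q: "q \<noteq> 0" "\<And>i. coeff q i \<in> k" "poly q x = 0"
    using alg[of x] by (auto simp: algebraic_over_def)
  define d where "d = degree q"
  have "d > 0"
  proof (rule ccontr)
    assume "\<not> d > 0"
    then obtain a where "q = [:a:]"
      unfolding d_def by (auto elim: degree_eq_zeroE)
    then show False
      using q by simp
  qed
  have lead: "coeff q d \<noteq> 0"
    using q by (simp add: d_def)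
  have "(\<Sum>i<d. coeff q i * x ^ i) + coeff q d * x ^ d = 0"
    using q(3) by (simp add: poly_altdef d_def flip: lessThan_Suc_atMost)
  then have "coeff q d * x ^ d = - (\<Sum>i<d. coeff q i * x ^ i)"
    by (simp add: add_eq_0_iff)
  then have "x ^ d = inverse (coeff q d) * - (\<Sum>i<d. coeff q i * x ^ i)"
    using lead by (simp add: field_simps)
  then have x_d: "x ^ d = (\<Sum>i<d. (- inverse (coeff q d) * coeff q i) * x ^ i)"
    by (simp add: sum_distrib_left sum_negf mult.assoc)
  \<comment> \<open>C is a generating set of M[x] over k, not necessarily a basis: q need not be the
    minimal polynomial of x over M.\<close>
  define C where "C = (\<lambda>(b, i). b * x ^ i) ` (B \<times> {..<d})"
  have fin: "finite C"
    using B by (simp add: C_def)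
  have base: "b * x ^ i \<in> span_over k C" if "b \<in> B" "i < d" for b i
    using that fin by (intro span_over_base) (auto simp: C_def)
  have small: "m * x ^ i \<in> span_over k C" if "m \<in> M" "i < d" for m i
  proof -
    have "span_over k B \<subseteq> {m. m * x ^ i \<in> span_over k C}"
      using that(2)
      by (intro span_over_least)
         (auto simp: span_over_0 distrib_right span_over_add mult.assoc intro!: span_over_scale base)
    then show ?thesis
      using that B by blast
  qed
  have shift: "y * x \<in> span_over k C" if "y \<in> span_over k C" for y
  proof -
    have "b * x ^ i * x \<in> span_over k C" if "b \<in> B" "i < d" for b i
    proof (cases "Suc i = d")
      \<comment> \<open>The only overflow: multiplying the top power by x gives
        \<open>x ^ d\<close>, which the relation \<open>x_d\<close> rewrites in lower
        powers.\<close>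
      case True
      then have "b * x ^ i * x = b * x ^ d"
        by (auto simp: mult_ac)
      also have "\<dots> = (\<Sum>i<d. (b * (- inverse (coeff q d) * coeff q i)) * x ^ i)"
        unfolding x_d by (simp add: sum_distrib_left mult.assoc)
      also have "\<dots> \<in> span_over k C"
      proof (intro span_over_sum small)
        fix i
        have "coeff q d \<in> M" "coeff q i \<in> M" "b \<in> M"
          using that(1) B(2) M(3) q(2) by blast+
        then show "b * (- inverse (coeff q d) * coeff q i) \<in> M"
          by (simp add: subfieldD(4-6)[OF M(1)])
      qed auto
      finally show ?thesis .
    next
      case False
      then show ?thesis
        using base[of b "Suc i"] that by (simp add: mult_ac)
    qed
    then have "\<forall>c\<in>C. c * x \<in> span_over k C"
      unfolding C_def by (simp add: case_prod_beta)
    then have "span_over k C \<subseteq> {y. y * x \<in> span_over k C}"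
      by (intro span_over_least)
         (auto simp: span_over_0 distrib_right span_over_add mult.assoc span_over_scale)
    then show ?thesis
      using that by blast
  qed
  have all: "m * x ^ n \<in> span_over k C" if "m \<in> M" for m n
  proof (induction n)
    case 0
    then show ?case
      using small[OF that \<open>d > 0\<close>] by simp
  next
    case (Suc n)
    then show ?case
      using shift[OF Suc] by (simp add: mult_ac)
  qed
  have M_C: "M \<subseteq> span_over k C"
    using all[of _ 0] by auto
  have "y * z \<in> span_over k C" if "y \<in> span_over k C" "z \<in> span_over k C" for y z
  proof (rule span_over_mult[OF fin fin fin _ that])
    fix b c assume "b \<in> C" "c \<in> C"
    then obtain b' i c' j where bc: "b = b' * x ^ i" "c = c' * x ^ j" "b' \<in> B" "c' \<in> B"
      by (auto simp: C_def)
    then have "b' * c' \<in> M"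
      using B(2) by (intro subfieldD(4)[OF M(1)]) auto
    then have "(b' * c') * x ^ (i + j) \<in> span_over k C"
      by (rule all)
    then show "b * c \<in> span_over k C"
      by (simp add: bc power_add mult_ac)
  qed
  then have "is_subfield (span_over k C)"
    using M_C M(3) span_over_add by (intro subring_is_subfield alg) blast+
  moreover have "x \<in> span_over k C"
    using all[of 1 1] subfieldD[OF M(1)] by simp
  ultimately have 1: "gen_subfield (insert x M) \<subseteq> span_over k C"
    using M_C by (intro gen_subfield_least) auto
  have gen: "is_subfield (gen_subfield (insert x M))" "insert x M \<subseteq> gen_subfield (insert x M)"
    by (rule subfield_gen_subfield subset_gen_subfield)+
  have 2: "C \<subseteq> gen_subfield (insert x M)"
    using gen(2) B(2) by (auto simp: C_def intro!: subfieldD(4)[OF gen(1)] subfield_power[OF gen(1)])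
  moreover have "span_over k C \<subseteq> gen_subfield (insert x M)"
    using gen(2) M(3) 2 by (intro span_over_least) (auto intro!: subfieldD(1,3,4)[OF gen(1)])
  ultimately show ?thesis
    using 1 fin unfolding finite_degree_iff by blast
qed

lemma finite_degree_gen_subfield:
  assumes alg: "\<And>x. algebraic_over k x" and "finite S"
  shows "finite_degree (gen_subfield (k \<union> S)) k"
  using \<open>finite S\<close>
proof induction
  case empty
  have "gen_subfield k = k"
    using gen_subfield_least[OF k] subset_gen_subfield by blast
  moreover have "span_over k {1} = k"
  proof
    show "span_over k {1} \<subseteq> k"
      by (auto simp: span_over_def)
    show "k \<subseteq> span_over k {1}"
      using span_over_scale[OF _ span_over_base[of "{1}" 1]] by fastforce
  qed
  ultimately show ?case
    using subfieldD[OF k] by (auto simp: finite_degree_iff intro!: exI[of _ "{1}"])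
next
  case (insert x S)
  let ?M = "gen_subfield (k \<union> S)"
  have "k \<subseteq> ?M" "S \<subseteq> ?M"
    using subset_gen_subfield[of "k \<union> S"] by auto
  then have "finite_degree (gen_subfield (insert x ?M)) k"
    using insert.IH by (intro finite_degree_adjoin alg subfield_gen_subfield)
  moreover have "gen_subfield (insert x ?M) = gen_subfield (k \<union> insert x S)"
  proof (intro subset_antisym gen_subfield_least subfield_gen_subfield)
    have "?M \<subseteq> gen_subfield (k \<union> insert x S)"
      using subset_gen_subfield[of "k \<union> insert x S"]
      by (intro gen_subfield_least subfield_gen_subfield) auto
    then show "insert x ?M \<subseteq> gen_subfield (k \<union> insert x S)"
      using subset_gen_subfield[of "k \<union> insert x S"] by auto
    show "k \<union> insert x S \<subseteq> gen_subfield (insert x ?M)"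
      using subset_gen_subfield[of "insert x ?M"] \<open>k \<subseteq> ?M\<close> \<open>S \<subseteq> ?M\<close> by auto
  qed
  ultimately show ?case by simp
qed

end

text \<open>Gaussian elimination: with a nonzero pivot \<open>g j0 b\<close>, the row operation
  \<open>g j0 b * g j c - g j b * g j0 c\<close> avoids division.\<close>

lemma linear_dependence_subring:
  fixes R :: "'r::idom set" and g :: "'i \<Rightarrow> 'b \<Rightarrow> 'r"
  assumes R: "0 \<in> R" "1 \<in> R" "\<And>x y. x \<in> R \<Longrightarrow> y \<in> R \<Longrightarrow> x + y \<in> R"
      "\<And>x y. x \<in> R \<Longrightarrow> y \<in> R \<Longrightarrow> x * y \<in> R" "\<And>x. x \<in> R \<Longrightarrow> - x \<in> R"
    and "finite B" "finite J" "card B < card J" "\<And>j b. j \<in> J \<Longrightarrow> b \<in> B \<Longrightarrow> g j b \<in> R"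
  shows "\<exists>h. (\<forall>j\<in>J. h j \<in> R) \<and> (\<exists>j\<in>J. h j \<noteq> 0) \<and> (\<forall>b\<in>B. (\<Sum>j\<in>J. h j * g j b) = 0)"
  using assms(6-9)
proof (induction B arbitrary: J g rule: finite_induct)
  case empty
  then have "J \<noteq> {}" by auto
  then show ?case
    using R(2) by (intro exI[of _ "\<lambda>_. 1"]) auto
next
  case (insert b B)
  show ?case
  proof (cases "\<forall>j\<in>J. g j b = 0")
    case True
    have "\<exists>h. (\<forall>j\<in>J. h j \<in> R) \<and> (\<exists>j\<in>J. h j \<noteq> 0) \<and> (\<forall>b\<in>B. (\<Sum>j\<in>J. h j * g j b) = 0)"
      using insert.prems insert.hyps by (intro insert.IH) auto
    then show ?thesis
      using True by auto
  next
    case False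
    then obtain j0 where j0: "j0 \<in> J" "g j0 b \<noteq> 0" by blast
    define J' where "J' = J - {j0}"
    \<comment> \<open>The difference is written with a unary minus to match the closure assumptions
      on R.\<close>
    define g' where "g' j c = g j0 b * g j c + - (g j b * g j0 c)" for j c
    have J': "finite J'" "J = insert j0 J'" "j0 \<notin> J'" "J' \<subseteq> J"
      using j0 insert.prems by (auto simp: J'_def)
    have "card B < card J'"
      using insert.prems insert.hyps J' by simp
    moreover have "g' j c \<in> R" if "j \<in> J'" "c \<in> B" for j c
      using that j0 insert.prems(3) J'(4) unfolding g'_def by (intro R) auto
    ultimately obtain h where h: "\<forall>j\<in>J'. h j \<in> R" "\<exists>j\<in>J'. h j \<noteq> 0"
        "\<forall>c\<in>B. (\<Sum>j\<in>J'. h j * g' j c) = 0"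
      using insert.IH[OF J'(1), of g'] by blast
    have sum_R: "sum f S \<in> R" if "\<And>i. i \<in> S \<Longrightarrow> f i \<in> R" for f and S :: "'i set"
      using that by (induction S rule: infinite_finite_induct) (auto intro: R)
    \<comment> \<open>Back substitution: scaling h by the pivot keeps the relations in the columns
      of B, and the entry at j0 is the one that cancels column b.\<close>
    define h' where "h' j = (if j = j0 then - (\<Sum>j\<in>J'. h j * g j b) else h j * g j0 b)" for j
    have sum_h': "(\<Sum>j\<in>J. h' j * g j c)
        = - (\<Sum>j\<in>J'. h j * g j b) * g j0 c + (\<Sum>j\<in>J'. h j * g j0 b * g j c)" for c
    proof -
      have "(\<Sum>j\<in>J'. h' j * g j c) = (\<Sum>j\<in>J'. h j * g j0 b * g j c)"
        using J'(3) by (intro sum.cong) (auto simp: h'_def)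
      then show ?thesis
        using J' by (simp add: h'_def)
    qed
    have "h' j \<in> R" if "j \<in> J" for j
      using that h(1) insert.prems(3) j0(1) J' unfolding h'_def by (auto intro!: R sum_R)
    moreover have "\<exists>j\<in>J. h' j \<noteq> 0"
      using h(2) j0(2) J' by (auto simp: h'_def)
    moreover have "(\<Sum>j\<in>J. h' j * g j c) = 0" if "c \<in> insert b B" for c
    proof (cases "c = b")
      case True
      then show ?thesis
        by (simp add: sum_h' sum_distrib_left sum_distrib_right mult_ac)
    next
      case False
      have "(\<Sum>j\<in>J. h' j * g j c) = (\<Sum>j\<in>J'. h j * g' j c)"
        by (simp add: sum_h' g'_def sum_distrib_left sum_distrib_right algebra_simps sum_subtractf)
      then show ?thesis
        using h(3) that False by simp
    qed
    ultimately show ?thesis by blast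
  qed
qed

subsection \<open>Separable roots\<close>

text \<open>Second-order Taylor expansion without division, hence valid in every characteristic. The
  cofactor Q stays unspecified, since later only the factor \<open>t\<^sup>2\<close> is used to
  bound the order of the remainder.\<close>

lemma poly_taylor_quadratic:
  fixes P :: "'r::idom poly"
  shows "\<exists>Q. poly P (x + t) = poly P x + poly (pderiv P) x * t + t\<^sup>2 * Q"
proof (induction P)
  case (pCons a P)
  then obtain Q where "poly P (x + t) = poly P x + poly (pderiv P) x * t + t\<^sup>2 * Q" by blast
  then have "poly (pCons a P) (x + t) = poly (pCons a P) x + poly (pderiv (pCons a P)) x * t
      + t\<^sup>2 * (poly (pderiv P) x + (x + t) * Q)"
    by (simp add: pderiv_pCons algebra_simps power2_eq_square)
  then show ?case by blast
qed simp

lemma coeff_pderiv_closed: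
  fixes P :: "'r::idom poly"
  assumes "0 \<in> R" "\<And>a b. a \<in> R \<Longrightarrow> b \<in> R \<Longrightarrow> a + b \<in> R" "\<And>i. coeff P i \<in> R"
  shows "coeff (pderiv P) i \<in> R"
proof -
  have "of_nat n * coeff P j \<in> R" for n j
    by (induction n) (auto simp: distrib_right assms)
  then show ?thesis
    by (simp only: coeff_pderiv)
qed

text \<open>The convention q = 1 in characteristic 0 agrees with \<open>frob_pow_set\<close> and
  lets both characteristics be treated together.\<close>

lemma power_char_power_add:
  fixes x y :: "'r::idom"
  assumes "q = (if CHAR('r) = 0 then 1 else CHAR('r) ^ r)"
  shows "(x + y) ^ q = x ^ q + y ^ q"
proof (cases "CHAR('r) = 0")
  case False
  then have "prime CHAR('r)"
    using prime_CHAR_semidom[where ?'a = 'r] by simp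
  then show ?thesis
    using freshmans_dream'[of q r x y] False assms by simp
qed (use assms in simp)

text \<open>A polynomial with vanishing derivative is a polynomial in \<open>X ^ p\<close>, so replacing the root by
  its \<open>p\<close>-th power lowers the degree.\<close>

lemma exists_separable_power:
  fixes P :: "'r::idom poly"
  assumes R: "0 \<in> R" "\<And>a b. a \<in> R \<Longrightarrow> b \<in> R \<Longrightarrow> a + b \<in> R"
    and "P \<noteq> 0" "\<And>i. coeff P i \<in> R" "poly P x = 0"
  shows "\<exists>r Q. (\<forall>i. coeff Q i \<in> R) \<and>
    poly Q (x ^ (if CHAR('r) = 0 then 1 else CHAR('r) ^ r)) = 0 \<and>
    poly (pderiv Q) (x ^ (if CHAR('r) = 0 then 1 else CHAR('r) ^ r)) \<noteq> 0"
  using assms(3-5)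
proof (induction "degree P" arbitrary: P x rule: less_induct)
  case less
  have deg: "degree P > 0"
  proof (rule ccontr)
    assume "\<not> degree P > 0"
    then obtain a where "P = [:a:]"
      using degree_eq_zeroE by blast
    then show False
      using less.prems by simp
  qed
  consider "poly (pderiv P) x \<noteq> 0" | "pderiv P \<noteq> 0" "poly (pderiv P) x = 0" | "pderiv P = 0"
    by auto
  then show ?case
  proof cases
    case 1
    then show ?thesis
      using less.prems by (intro exI[of _ 0] exI[of _ P]) auto
  next
    case 2
    \<comment> \<open>Here the derivative itself is a nonzero polynomial of smaller degree with root
      x, so the induction continues with the same x.\<close>
    have "degree (pderiv P) \<le> degree P - 1"
      by (intro degree_le) (auto simp: coeff_pderiv coeff_eq_0)
    then have "degree (pderiv P) < degree P"
      using deg by linarith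
    moreover have "coeff (pderiv P) i \<in> R" for i
      using R less.prems(2) by (rule coeff_pderiv_closed)
    ultimately show ?thesis
      using less.hyps[OF _ 2(1) _ 2(2)] by blast
  next
    case 3
    define p where "p = CHAR('r)"
    have dvd: "p dvd i" if "coeff P i \<noteq> 0" for i
    proof (cases i)
      case (Suc j)
      have "coeff (pderiv P) j = 0"
        using 3 by simp
      then have "of_nat i = (0 :: 'r)"
        using that Suc by (simp add: coeff_pderiv del: of_nat_Suc)
      then show ?thesis
        by (simp add: p_def of_nat_eq_0_iff_char_dvd)
    qed simp
    have "coeff P (degree P) \<noteq> 0"
      using deg by auto
    then have "p dvd degree P"
      by (rule dvd)
    then obtain d where d: "degree P = p * d"
      by (rule dvdE)
    \<comment> \<open>Characteristic 0 is excluded here: the degree of P is positive and equals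
      \<open>p * d\<close>.\<close>
    have "p > 0" "d > 0"
      using d deg by (auto intro!: gr0I)
    have "prime p"
      using \<open>p > 0\<close> unfolding p_def by (rule prime_CHAR_semidom)
    then have "p > 1"
      by (rule prime_gt_1_nat)
    \<comment> \<open>Q is chosen so that substituting the p-th power of the variable gives back
      P.\<close>
    define Q where "Q = (\<Sum>i\<le>d. monom (coeff P (p * i)) i)"
    have coeff_Q: "coeff Q i = (if i \<le> d then coeff P (p * i) else 0)" for i
      by (simp add: Q_def coeff_sum)
    have "degree Q \<le> d"
      by (intro degree_le) (simp add: coeff_Q)
    also have "d < degree P"
      using d \<open>p > 1\<close> \<open>d > 0\<close> by simp
    finally have "degree Q < degree P" .
    moreover have "Q \<noteq> 0"
      using coeff_Q[of d] d \<open>coeff P (degree P) \<noteq> 0\<close> by auto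
    moreover have "coeff Q i \<in> R" for i
      using less.prems R(1) by (simp add: coeff_Q)
    moreover have "poly Q (x ^ p) = 0"
    proof -
      have "poly P x = (\<Sum>i\<le>p * d. coeff P i * x ^ i)"
        by (simp add: poly_altdef d)
      also have "\<dots> = (\<Sum>i\<in>(\<lambda>i. p * i) ` {..d}. coeff P i * x ^ i)"
      proof (intro sum.mono_neutral_right ballI)
        fix i assume i: "i \<in> {..p * d} - (\<lambda>i. p * i) ` {..d}"
        have "\<not> p dvd i"
        proof
          assume "p dvd i"
          then obtain j where "i = p * j"
            by (rule dvdE)
          then show False
            using i \<open>p > 0\<close> by auto
        qed
        then show "coeff P i * x ^ i = 0"
          using dvd by auto
      qed (use \<open>p > 0\<close> in auto)
      also have "\<dots> = poly Q (x ^ p)"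
        using \<open>p > 0\<close>
        by (subst sum.reindex) (auto simp: inj_on_def Q_def poly_sum poly_monom power_mult)
      finally show ?thesis
        using less.prems by simp
    qed
    ultimately obtain r Q' where *: "\<forall>i. coeff Q' i \<in> R"
        "poly Q' ((x ^ p) ^ (p ^ r)) = 0" "poly (pderiv Q') ((x ^ p) ^ (p ^ r)) \<noteq> 0"
      using less.hyps[of Q "x ^ p"] \<open>p > 0\<close> unfolding p_def by auto
    have "(x ^ p) ^ (p ^ r) = x ^ (p ^ Suc r)"
      by (simp add: power_mult)
    then show ?thesis
      using * \<open>p > 0\<close> by (intro exI[of _ "Suc r"] exI[of _ Q']) (simp add: p_def)
  qed
qed

text \<open>A simple root is determined by an initial part of its expansion, as in Newton
  approximation: each later coefficient solves a linear equation whose leading coefficient is the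
  lowest one of P'(\<tau>).\<close>

lemma separable_root_finitely_generated:
  fixes \<tau> :: "('v::finite, 'a::field) mseries"
  assumes k: "is_subfield k"
    and P: "\<And>i. coeff P i \<in> series_over k" "poly P \<tau> = 0" "poly (pderiv P) \<tau> \<noteq> 0"
  shows "\<exists>S. finite S \<and> \<tau> \<in> series_over (gen_subfield (k \<union> mcoeff \<tau> ` S))"
proof -
  define \<delta> where "\<delta> = poly (pderiv P) \<tau>"
  obtain e where e: "mcoeff \<delta> e \<noteq> 0" "vanishes_below (weight e) \<delta>"
    using lowest_exponent[of \<delta>] P(3) unfolding \<delta>_def by blast
  \<comment> \<open>Outside S the strict inequality \<open>weight e < weight I\<close> holds; both
    remainder estimates below rest on it.\<close>
  define S where "S = {A :: 'v \<Rightarrow> nat. weight A \<le> weight e}"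
  define F where "F = gen_subfield (k \<union> mcoeff \<tau> ` S)"
  have F: "is_subfield F"
    unfolding F_def by (rule subfield_gen_subfield)
  have F_sup: "k \<subseteq> F" "mcoeff \<tau> ` S \<subseteq> F"
    using subset_gen_subfield[of "k \<union> mcoeff \<tau> ` S"] by (auto simp: F_def)
  have P_F: "coeff P i \<in> series_over F" for i
    using P(1)[of i] F_sup(1) by (auto simp: series_over_def)
  have P'_F: "coeff (pderiv P) i \<in> series_over F" for i
    using series_over_0[OF F] series_over_add[OF F] P_F by (rule coeff_pderiv_closed)
  have "mcoeff \<tau> I \<in> F" for I
  proof (induction "weight I" arbitrary: I rule: less_induct)
    case less
    show ?case
    proof (cases "weight I \<le> weight e")
      case True
      then show ?thesis
        using F_sup(2) by (auto simp: S_def)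
    next
      case False
      define s where "s = restrict_exponents {A. weight A < weight I} \<tau>"
      define t where "t = \<tau> - s"
      have s_F: "s \<in> series_over F"
        using less subfieldD(1)[OF F]
        by (auto simp: s_def series_over_def mcoeff_restrict_exponents)
      have t: "vanishes_below (weight I) t" "mcoeff t I = mcoeff \<tau> I"
        by (auto simp: t_def s_def vanishes_below_def mcoeff_restrict_exponents)
      have "s + t = \<tau>" "\<tau> + - t = s"
        by (simp_all add: t_def)
      obtain Q1 where Q1: "poly P s = poly P \<tau> + \<delta> * - t + (- t)\<^sup>2 * Q1"
        using poly_taylor_quadratic[of P \<tau> "- t"] \<open>\<tau> + - t = s\<close> by (auto simp: \<delta>_def)
      \<comment> \<open>\<delta> is built from all of \<tau>, so its coefficient at e is not
        obviously in F. Expanding around s shows that \<delta> and P'(s) differ by a multiple of t,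
        which cannot reach e.\<close>
      obtain Q2 where Q2: "\<delta> = poly (pderiv P) s + poly (pderiv (pderiv P)) s * t + t\<^sup>2 * Q2"
        using poly_taylor_quadratic[of "pderiv P" s t] \<open>s + t = \<tau>\<close> by (auto simp: \<delta>_def)
      have "vanishes_below (weight I * 1) (t * (poly (pderiv (pderiv P)) s + t * Q2))"
        by (intro vanishes_below_mult t vanishes_below_1)
      moreover have "\<delta> = poly (pderiv P) s + t * (poly (pderiv (pderiv P)) s + t * Q2)"
        by (subst Q2) (simp add: algebra_simps power2_eq_square)
      ultimately have "mcoeff \<delta> e = mcoeff (poly (pderiv P) s) e"
        using False by (simp add: vanishes_below_def)
      then have \<delta>_F: "mcoeff \<delta> e \<in> F"
        using series_over_poly[OF F P'_F s_F] by (simp add: series_over_def)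
      have "vanishes_below (weight I * weight I * 1) (t * t * Q1)"
        by (intro vanishes_below_mult t vanishes_below_1)
      \<comment> \<open>The quadratic remainder starts at \<open>weight I * weight I\<close>, beyond
        e + I, so only the linear term contributes there.\<close>
      moreover have "weight (e + I) < weight I * weight I"
        using False by (simp add: weight_add)
      ultimately have "mcoeff (t * t * Q1) (e + I) = 0"
        by (simp add: vanishes_below_def)
      moreover have "poly P s = - (\<delta> * t) + t * t * Q1"
        using Q1 P(2) by (simp add: power2_eq_square)
      ultimately have "mcoeff (poly P s) (e + I) = - (mcoeff \<delta> e * mcoeff \<tau> I)"
        using mcoeff_mult_lowest[OF e(2) t(1)] t(2) by simp
      then have "mcoeff \<tau> I = inverse (mcoeff \<delta> e) * - mcoeff (poly P s) (e + I)"
        using e(1) by simp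
      moreover have "mcoeff (poly P s) (e + I) \<in> F"
        using series_over_poly[OF F P_F s_F] by (simp add: series_over_def)
      ultimately show ?thesis
        using \<delta>_F subfieldD[OF F] by auto
    qed
  qed
  then show ?thesis
    using finite_weight_le unfolding F_def S_def series_over_def by blast
qed

section \<open>Frobenius powers of the coefficient field and the equivalence\<close>

lemma frob_pow_set_altdef:
  fixes L :: "'a::field set"
  shows "frob_pow_set L r = (\<lambda>x. x ^ (if CHAR('a) = 0 then 1 else CHAR('a) ^ r)) ` L"
  by (auto simp: frob_pow_set_def)

text \<open>Links the field generated by the coefficients of the q-th power of a series with the
  field generated by the q-th powers of its coefficients; each part yields one inclusion.\<close>

lemma mcoeff_power_char_power:
  fixes f :: "('v::finite, 'a::field) mseries"
  assumes q: "q = (if CHAR('a) = 0 then 1 else CHAR('a) ^ r)"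
  shows "mcoeff (f ^ q) (\<lambda>v. q * A v) = mcoeff f A ^ q"
    and "mcoeff (f ^ q) J \<noteq> 0 \<Longrightarrow> \<exists>A. mcoeff (f ^ q) J = mcoeff f A ^ q"
proof -
  have "q > 0"
    using q by simp
  have sum: "mcoeff (f ^ q) J = (\<Sum>A | (\<lambda>v. q * A v) = J. mcoeff f A ^ q)" for J
    using q mcoeff_power_CHAR[of q r f J] by (cases "CHAR('a) = 0") auto
  have "(\<lambda>v. q * B v) = (\<lambda>v. q * A v) \<longleftrightarrow> B = A" for A B :: "'v \<Rightarrow> nat"
    using \<open>q > 0\<close> by (simp add: fun_eq_iff)
  then show *: "mcoeff (f ^ q) (\<lambda>v. q * A v) = mcoeff f A ^ q" for A
    by (simp add: sum)
  assume "mcoeff (f ^ q) J \<noteq> 0"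
  then have "{A. (\<lambda>v. q * A v) = J} \<noteq> {}"
    unfolding sum by (metis sum.empty)
  then obtain A where "J = (\<lambda>v. q * A v)"
    by blast
  then show "\<exists>A. mcoeff (f ^ q) J = mcoeff f A ^ q"
    using * by blast
qed

theorem theorem3p2:
  fixes k :: "'K::field set" and \<sigma> :: "('v::finite, 'K) mps"
  assumes "is_subfield k"
    and "is_algebraic_closure_of k"
  shows "mps_algebraic_over k \<sigma> \<longleftrightarrow>
    (\<exists>r::nat. finite_degree
        (gen_subfield (k \<union> frob_pow_set (gen_subfield (k \<union> range \<sigma>)) r)) k)"
proof
  note k = assms(1)
  have alg: "algebraic_over k x" for x
    using assms(2) by (simp add: is_algebraic_closure_of_def)
  define f where "f = Abs_mseries \<sigma>"
  have f: "mcoeff f = \<sigma>"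
    by (simp add: f_def Abs_mseries_inverse)
  define L where "L = gen_subfield (k \<union> range \<sigma>)"
  have L: "is_subfield L" "k \<subseteq> L" "range \<sigma> \<subseteq> L"
    using subfield_gen_subfield subset_gen_subfield[of "k \<union> range \<sigma>"] by (auto simp: L_def)
  define frob :: "nat \<Rightarrow> nat" where "frob r = (if CHAR('K) = 0 then 1 else CHAR('K) ^ r)" for r
  have E_altdef: "gen_subfield (k \<union> frob_pow_set L r) = gen_subfield (k \<union> (\<lambda>x. x ^ frob r) ` L)" for r
    by (simp add: frob_pow_set_altdef frob_def)
  have power_E: "f ^ frob r \<in> series_over (gen_subfield (k \<union> (\<lambda>x. x ^ frob r) ` L))" for r
  proof -
    have "mcoeff (f ^ frob r) J \<in> gen_subfield (k \<union> (\<lambda>x. x ^ frob r) ` L)" for J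
    proof (cases "mcoeff (f ^ frob r) J = 0")
      case True
      then show ?thesis
        using subfieldD(1)[OF subfield_gen_subfield] by simp
    next
      case False
      then obtain A where "mcoeff (f ^ frob r) J = \<sigma> A ^ frob r"
        using mcoeff_power_char_power(2)[OF frob_def] f by metis
      then show ?thesis
        using L(3) subset_gen_subfield[of "k \<union> (\<lambda>x. x ^ frob r) ` L"] by auto
    qed
    then show ?thesis
      by (simp add: series_over_def)
  qed
  {
    assume "mps_algebraic_over k \<sigma>"
    then obtain P where "P \<noteq> 0" "\<And>i. coeff P i \<in> series_over k" "poly P f = 0"
      using mps_algebraic_over_iff[OF k] unfolding f_def by blast
    then obtain r Q where Q: "\<And>i. coeff Q i \<in> series_over k" "poly Q (f ^ frob r) = 0"
        "poly (pderiv Q) (f ^ frob r) \<noteq> 0"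
      using exists_separable_power[of "series_over k" P f] series_over_0[OF k] series_over_add[OF k]
      unfolding CHAR_mseries frob_def by blast
    define q where "q = frob r"
    obtain S where S: "finite S" "f ^ q \<in> series_over (gen_subfield (k \<union> mcoeff (f ^ q) ` S))"
      using separable_root_finitely_generated[OF k Q] unfolding q_def by blast
    \<comment> \<open>F is finitely generated over k by construction; it remains to identify it with
      the compositum of k and the q-th powers of L.\<close>
    define F where "F = gen_subfield (k \<union> mcoeff (f ^ q) ` S)"
    have F: "is_subfield F" "k \<subseteq> F"
      using subfield_gen_subfield subset_gen_subfield[of "k \<union> mcoeff (f ^ q) ` S"]
      by (auto simp: F_def)
    have "gen_subfield (k \<union> (\<lambda>x. x ^ q) ` L) = F"
    proof
      have add: "(x + y) ^ q = x ^ q + y ^ q" for x y :: 'K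
        using power_char_power_add[of q r x y] by (simp add: q_def frob_def)
      have "q > 0"
        by (simp add: q_def frob_def)
      have "(- x) ^ q = - (x ^ q)" for x :: 'K
        using add[of x "- x"] \<open>q > 0\<close> by (simp add: zero_power eq_neg_iff_add_eq_0 add.commute)
      \<comment> \<open>The preimage of F under the q-th power map is a subfield, so to contain L it
        only has to contain the generators of L.\<close>
      then have "is_subfield {x. x ^ q \<in> F}"
        using \<open>q > 0\<close> unfolding is_subfield_def
        by (auto simp: add zero_power power_mult_distrib power_inverse subfieldD[OF F(1)])
      moreover have "k \<union> range \<sigma> \<subseteq> {x. x ^ q \<in> F}"
      proof -
        have "\<sigma> A ^ q \<in> F" for A
        proof -
          have "mcoeff (f ^ q) (\<lambda>v. q * A v) = \<sigma> A ^ q"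
            using mcoeff_power_char_power(1)[of q r f A] f by (simp add: q_def frob_def)
          then show ?thesis
            using S(2) unfolding F_def series_over_def by (metis mem_Collect_eq)
        qed
        then show ?thesis
          using F by (auto intro: subfield_power)
      qed
      ultimately have "L \<subseteq> {x. x ^ q \<in> F}"
        unfolding L_def by (rule gen_subfield_least)
      then show "gen_subfield (k \<union> (\<lambda>x. x ^ q) ` L) \<subseteq> F"
        using F by (intro gen_subfield_least) auto
      show "F \<subseteq> gen_subfield (k \<union> (\<lambda>x. x ^ q) ` L)"
        unfolding F_def
      proof (intro gen_subfield_least subfield_gen_subfield)
        show "k \<union> mcoeff (f ^ q) ` S \<subseteq> gen_subfield (k \<union> (\<lambda>x. x ^ q) ` L)"
          using power_E[of r] subset_gen_subfield[of "k \<union> (\<lambda>x. x ^ q) ` L"]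
          by (auto simp: series_over_def q_def)
      qed
    qed
    moreover have "finite_degree F k"
      unfolding F_def using S(1) by (intro finite_degree_gen_subfield k alg) auto
    ultimately show "\<exists>r. finite_degree (gen_subfield (k \<union> frob_pow_set L r)) k"
      unfolding E_altdef q_def by metis
  }
  {
    assume "\<exists>r. finite_degree (gen_subfield (k \<union> frob_pow_set L r)) k"
    then obtain r where "finite_degree (gen_subfield (k \<union> (\<lambda>x. x ^ frob r) ` L)) k"
      unfolding E_altdef by blast
    then obtain B where B: "finite B" "gen_subfield (k \<union> (\<lambda>x. x ^ frob r) ` L) = span_over k B"
      by (auto simp: finite_degree_iff)
    define q where "q = frob r"
    have "q > 0"
      by (simp add: q_def frob_def)
    have E: "is_subfield (span_over k B)"
      using B(2) subfield_gen_subfield by metis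
    \<comment> \<open>E[[X]] is generated over k[[X]] by the finite set B: every coefficient is
      expanded in B separately, and the coordinates are collected into series.\<close>
    have coeffs: "\<exists>g. (\<forall>b. g b \<in> series_over k) \<and> h = (\<Sum>b\<in>B. g b * mmonom b 0)"
      if h: "h \<in> series_over (span_over k B)" for h :: "('v, 'K) mseries"
    proof -
      have "\<exists>c. (\<forall>b\<in>B. c b \<in> k) \<and> mcoeff h A = (\<Sum>b\<in>B. c b * b)" for A
        using h by (force simp: series_over_def span_over_def)
      then obtain c where c: "\<And>A b. b \<in> B \<Longrightarrow> c A b \<in> k" "\<And>A. mcoeff h A = (\<Sum>b\<in>B. c A b * b)"
        by metis
      \<comment> \<open>The value 0 outside B puts \<open>g b\<close> into k[[X]] for every
        b.\<close>
      define g where "g b = Abs_mseries (\<lambda>A. if b \<in> B then c A b else 0)" for b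
      have "h = (\<Sum>b\<in>B. g b * mmonom b 0)"
        by (rule mseries_eqI)
          (auto simp: mult.commute[of _ "mmonom _ _"] mcoeff_mmonom_0_mult g_def c(2)
            Abs_mseries_inverse mult.commute intro!: sum.cong)
      moreover have "g b \<in> series_over k" for b
        using c(1) subfieldD(1)[OF k] by (simp add: g_def series_over_def Abs_mseries_inverse)
      ultimately show ?thesis by blast
    qed
    have "f ^ q \<in> series_over (span_over k B)"
      using power_E[of r] B(2) by (simp add: q_def)
    then have "(f ^ q) ^ j \<in> series_over (span_over k B)" for j
      by (rule series_over_power[OF E])
    then have "\<forall>j. \<exists>g. (\<forall>b. g b \<in> series_over k) \<and> (f ^ q) ^ j = (\<Sum>b\<in>B. g b * mmonom b 0)"
      using coeffs by blast
    from choice[OF this] obtain g where g: "\<And>j b. g j b \<in> series_over k"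
        "\<And>j. (f ^ q) ^ j = (\<Sum>b\<in>B. g j b * mmonom b 0)"
      by blast
    \<comment> \<open>The indices 0 to \<open>card B\<close> are one more than the generators, which
      forces a linear dependence.\<close>
    let ?J = "{..card B}"
    have "\<exists>h. (\<forall>j\<in>?J. h j \<in> series_over k) \<and> (\<exists>j\<in>?J. h j \<noteq> 0) \<and>
        (\<forall>b\<in>B. (\<Sum>j\<in>?J. h j * g j b) = 0)"
      using B(1) g(1)
      by (intro linear_dependence_subring series_over_0 series_over_1 series_over_add
          series_over_mult series_over_uminus k) simp_all
    then obtain h where h: "\<forall>j\<in>?J. h j \<in> series_over k" "\<exists>j\<in>?J. h j \<noteq> 0"
        "\<forall>b\<in>B. (\<Sum>j\<in>?J. h j * g j b) = 0"
      by blast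
    \<comment> \<open>A relation between the powers of \<open>f ^ q\<close> is a polynomial relation
      for f with exponents q j. They are distinct because q is positive, so no coefficients merge
      and P stays nonzero.\<close>
    define P where "P = (\<Sum>j\<in>?J. monom (h j) (q * j))"
    have "coeff P (q * j) = h j" if "j \<in> ?J" for j
      using that \<open>q > 0\<close> by (simp add: P_def coeff_sum)
    then have "P \<noteq> 0"
      using h(2) by (metis coeff_0)
    moreover have "coeff P i \<in> series_over k" for i
      unfolding P_def coeff_sum coeff_monom
      using h(1) by (intro series_over_sum k) (auto intro: series_over_0[OF k])
    moreover have "poly P f = 0"
    proof -
      have "poly P f = (\<Sum>j\<in>?J. h j * (f ^ q) ^ j)"
        by (simp add: P_def poly_sum poly_monom power_mult)
      also have "\<dots> = (\<Sum>j\<in>?J. \<Sum>b\<in>B. h j * g j b * mmonom b 0)"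
        by (simp add: g(2) sum_distrib_left mult.assoc)
      also have "\<dots> = (\<Sum>b\<in>B. (\<Sum>j\<in>?J. h j * g j b) * mmonom b 0)"
        by (subst sum.swap) (simp add: sum_distrib_right)
      also have "\<dots> = 0"
        using h(3) by simp
      finally show ?thesis .
    qed
    ultimately show "mps_algebraic_over k \<sigma>"
      unfolding mps_algebraic_over_iff[OF k] f_def by blast
  }
qed

end
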